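(* Let $k$ be a positive integer with $k \equiv 4 \pmod 5$ and let \[ n = L_{CC}(10,k) = \frac{512k^5+1280k^4+6400k^3+8640k^2+6890k+757}{3125}. \] Then there is an undirected Cayley graph of the cyclic group $\mathbb{Z}_n$ on five generators which has diameter $k$. Moreover, a generating set for such a graph is \[ \Big\{1,\ \tfrac{32k^3+56k^2+316k+167}{125},\ \tfrac{128k^4+192k^3+1408k^2+1002k+908}{625},\ \tfrac{128k^4+352k^3+1488k^2+2432k+543}{625},\ \tfrac{256k^4+384k^3+2616k^2+1354k+116}{625}\Big\}, \] i.e. the Cayley graph of $\mathbb{Z}_n$ with connection set $\{\pm g_1,\dots,\pm g_5\}$, where $g_1,\dots,g_5$ are these integers taken modulo $n$, has diameter $k$.
   Context: For a positive integer $n$ and integers $g_1,\dots,g_5$, the undirected Cayley (circulant) graph of the cyclic group $\mathbb{Z}_n$ with generating set $\{g_1,\dots,g_5\}$ has vertex set $\mathbb{Z}_n$, with $i$ and $j$ adjacent if and only if $j-i \equiv \pm g_t \pmod n$ for some $t$. Its diameter is the maximum over pairs of vertices of the graph distance. The notation $L_{CC}(10,k)$ is just a name for the displayed polynomial value. *)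

theory Defs
  imports "Graph_Theory.Graph_Theory" "HOL-Number_Theory.Cong"
begin

text \<open>
  The elements of \<open>\<int>\<^sub>n\<close> are represented by the residues \<open>0, \<dots>, n - 1\<close>.  An undirected graph is
  a symmetric digraph; loops would only arise from generators that are \<open>0\<close> modulo \<open>n\<close>.
\<close>

definition cyclic_cayley_graph :: "int \<Rightarrow> int set \<Rightarrow> int pair_pre_digraph" where
  "cyclic_cayley_graph n S =
    \<lparr> pverts = {0..<n},
      parcs = {(i, j). i \<in> {0..<n} \<and> j \<in> {0..<n} \<and>
                       (\<exists>g\<in>S. [j - i = g] (mod n) \<or> [j - i = - g] (mod n))} \<rparr>"

lemma pair_pseudo_graph_cyclic_cayley_graph: "pair_pseudo_graph (cyclic_cayley_graph n S)"
proof
  let ?G = "cyclic_cayley_graph n S"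
  have sub: "parcs ?G \<subseteq> {0..<n} \<times> {0..<n}"
    by (auto simp: cyclic_cayley_graph_def)
  show "fst e \<in> pverts ?G" "snd e \<in> pverts ?G" if "e \<in> parcs ?G" for e
    using that by (auto simp: cyclic_cayley_graph_def)
  show "finite (pverts ?G)"
    by (simp add: cyclic_cayley_graph_def)
  show "finite (parcs ?G)"
    using sub by (rule finite_subset) simp
  have "[i - j = - g] (mod n) \<longleftrightarrow> [j - i = g] (mod n)"
    "[i - j = g] (mod n) \<longleftrightarrow> [j - i = - g] (mod n)" for i j g
    using cong_minus_minus_iff[of "j - i" g n] cong_minus_minus_iff[of "j - i" "- g" n] by auto
  then show "symmetric (with_proj ?G)"
    by (auto simp: symmetric_def sym_def cyclic_cayley_graph_def)
qed

text \<open>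
  The distance of two vertices is the minimal cost of a walk where every arc has cost \<open>1\<close>; it is
  \<open>\<infinity>\<close> if there is no walk.  On a finite nonempty vertex set the supremum is a maximum.
\<close>

definition graph_diameter :: "('a, 'b) pre_digraph \<Rightarrow> ereal" where
  "graph_diameter G = (SUP u \<in> verts G. SUP v \<in> verts G. wf_digraph.\<mu> G (\<lambda>_. 1) u v)"

definition L_CC_10 :: "int \<Rightarrow> rat" where
  "L_CC_10 k = of_int (512*k^5 + 1280*k^4 + 6400*k^3 + 8640*k^2 + 6890*k + 757) / 3125"

definition L_CC_10_generators :: "int \<Rightarrow> rat set" where
  "L_CC_10_generators k =
    {1,
     of_int (32*k^3 + 56*k^2 + 316*k + 167) / 125,
     of_int (128*k^4 + 192*k^3 + 1408*k^2 + 1002*k + 908) / 625,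
     of_int (128*k^4 + 352*k^3 + 1488*k^2 + 2432*k + 543) / 625,
     of_int (256*k^4 + 384*k^3 + 2616*k^2 + 1354*k + 116) / 625}"

end

theory Submission
  imports Defs
begin

text \<open>
  Write \<open>k = 5 m + 4\<close>.  The integer relations between the generators modulo \<open>n\<close> form the lattice
  spanned by the rows of an almost diagonal matrix \<open>e\<close> with diagonal
  \<open>(4m+4, 4m+3, 4m+3, 4m+4, 4m+4)\<close> and off-diagonal entries in \<open>{-1, 0, 1}\<close>, together with half the
  sum of the rows.  It is thus a small perturbation of the multiple \<open>2(m+1)\<close> of the lattice
  of integer vectors with all coordinates of the same parity.

  Upper bound: every orthant contains a relation of norm \<open>2k + 1\<close> (in the \<open>l\<^sub>1\<close> norm) close
  to \<open>(\<plusminus>(2m+2), \<dots>, \<plusminus>(2m+2))\<close>.  If a vector \<open>x\<close> of minimal norm in its coset lies between \<open>0\<close> and the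
  relation \<open>r\<close> of its orthant, then \<open>2 |x| \<le> |x| + |r - x| = 2k + 1\<close>; the vectors outside these
  boxes are excluded by comparison with relations close to \<open>(4m+4) (\<plusminus>u\<^sub>i \<plusminus> u\<^sub>j)\<close> and \<open>\<plusminus>(4m+4) u\<^sub>i\<close>
  for unit vectors \<open>u\<^sub>i\<close> and with the relations of neighbouring orthants.

  Lower bound: \<open>(m+1, m+1, m, m+1, m+1)\<close> has norm \<open>k\<close>, is at distance \<open>k + 1\<close> from the relation
  \<open>(2m+2, 2m+2, 2m+1, 2m+2, 2m+2)\<close>, and by diagonal dominance of \<open>e\<close> all other relations are
  farther away.
\<close>

section \<open>Walks in a cyclic Cayley graph as words in the signed generators\<close>

lemma awalk_of_steps:
  fixes n :: int
  assumes "0 < n" and "u \<in> {0..<n}" and "set ss \<subseteq> S \<union> uminus ` S"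
  shows "\<exists>p. pre_digraph.awalk (with_proj (cyclic_cayley_graph n S)) u p ((u + sum_list ss) mod n) \<and>
    length p = length ss"
  using assms(2,3)
proof (induction ss arbitrary: u)
  case Nil
  interpret pair_pseudo_graph "cyclic_cayley_graph n S"
    by (rule pair_pseudo_graph_cyclic_cayley_graph)
  have "u \<in> verts (with_proj (cyclic_cayley_graph n S))"
    using Nil by (simp add: cyclic_cayley_graph_def)
  then show ?case
    using Nil by (intro exI[of _ "[]"]) (simp add: awalk_Nil_iff)
next
  case (Cons s ss)
  interpret pair_pseudo_graph "cyclic_cayley_graph n S"
    by (rule pair_pseudo_graph_cyclic_cayley_graph)
  let ?w = "(u + s) mod n"
  have w: "?w \<in> {0..<n}"
    using assms(1) by simp
  then obtain p where p: "awalk ?w p ((?w + sum_list ss) mod n)" "length p = length ss"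
    using Cons.IH[of ?w] Cons.prems(2) by auto
  have "[?w - u = s] (mod n)"
    by (simp add: cong_def mod_diff_left_eq)
  then have "(u, ?w) \<in> parcs (cyclic_cayley_graph n S)"
    using Cons.prems w by (auto simp: cyclic_cayley_graph_def)
  then have "awalk u ((u, ?w) # p) ((u + sum_list (s # ss)) mod n)"
    using p(1) by (simp add: awalk_Cons_iff mod_add_left_eq add.assoc)
  then show ?case
    using p(2) by (intro exI[of _ "(u, ?w) # p"]) simp
qed

lemma steps_of_awalk:
  fixes n :: int
  assumes "pre_digraph.awalk (with_proj (cyclic_cayley_graph n S)) u p v"
  shows "\<exists>ss. set ss \<subseteq> S \<union> uminus ` S \<and> length ss = length p \<and> [v = u + sum_list ss] (mod n)"
  using assms
proof (induction p arbitrary: u)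
  case Nil
  interpret pair_pseudo_graph "cyclic_cayley_graph n S"
    by (rule pair_pseudo_graph_cyclic_cayley_graph)
  from Nil show ?case
    by (auto simp: awalk_Nil_iff)
next
  case (Cons e p)
  interpret pair_pseudo_graph "cyclic_cayley_graph n S"
    by (rule pair_pseudo_graph_cyclic_cayley_graph)
  from Cons.prems have e: "e \<in> parcs (cyclic_cayley_graph n S)" "u = fst e" "awalk (snd e) p v"
    by (auto simp: awalk_Cons_iff)
  from Cons.IH[OF e(3)] obtain ss where ss: "set ss \<subseteq> S \<union> uminus ` S" "length ss = length p"
    "[v = snd e + sum_list ss] (mod n)"
    by blast
  from e(1,2) obtain g where "g \<in> S" "[snd e - u = g] (mod n) \<or> [snd e - u = - g] (mod n)"
    by (auto simp: cyclic_cayley_graph_def)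
  then obtain s where s: "s \<in> S \<union> uminus ` S" "[snd e - u = s] (mod n)"
    by blast
  have "[snd e = u + s] (mod n)"
    using cong_add[OF cong_refl[of u] s(2)] by simp
  then have "[snd e + sum_list ss = u + s + sum_list ss] (mod n)"
    by (intro cong_add cong_refl)
  with ss(3) have "[v = u + (s + sum_list ss)] (mod n)"
    by (simp add: cong_def add.assoc)
  then show ?case
    using ss s(1) by (intro exI[of _ "s # ss"]) auto
qed

lemma (in wf_digraph) awalk_cost_1: "awalk_cost (\<lambda>_. 1) p = real (length p)"
  by (induction p) simp_all

text \<open>Reading off the steps turns a walk from \<open>u\<close> to \<open>v\<close> into a word
  in the signed generators with sum congruent to \<open>v - u\<close>, and conversely. Distances are
  therefore invariant under translation: \<open>upper\<close> need only treat residues instead of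
  pairs of vertices, and a single residue \<open>v0\<close>, seen from the vertex 0, gives the lower
  bound.\<close>

lemma graph_diameter_cyclic_cayley_graph_eqI:
  fixes n :: int
  assumes "0 < n"
    and upper: "\<And>v. \<exists>ss. set ss \<subseteq> S \<union> uminus ` S \<and> length ss \<le> k \<and> [sum_list ss = v] (mod n)"
    and lower: "\<And>ss. set ss \<subseteq> S \<union> uminus ` S \<Longrightarrow> [sum_list ss = v0] (mod n) \<Longrightarrow> k \<le> length ss"
  shows "graph_diameter (with_proj (cyclic_cayley_graph n S)) = ereal (real k)"
proof -
  interpret pair_pseudo_graph "cyclic_cayley_graph n S"
    by (rule pair_pseudo_graph_cyclic_cayley_graph)
  have verts: "pverts (cyclic_cayley_graph n S) = {0..<n}"
    by (simp add: cyclic_cayley_graph_def)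
  show ?thesis
  proof (rule antisym)
    have "\<mu> (\<lambda>_. 1) u v \<le> ereal (real k)" if uv: "u \<in> {0..<n}" "v \<in> {0..<n}" for u v
    proof -
      obtain ss where ss: "set ss \<subseteq> S \<union> uminus ` S" "length ss \<le> k" "[sum_list ss = v - u] (mod n)"
        using upper by blast
      have "[u + sum_list ss = v] (mod n)"
        using cong_add[OF cong_refl[of u] ss(3)] by simp
      then have "(u + sum_list ss) mod n = v"
        using uv by (simp add: cong_def)
      then obtain p where "awalk u p v" "length p = length ss"
        using awalk_of_steps[OF assms(1) uv(1) ss(1)] by auto
      then have "\<mu> (\<lambda>_. 1) u v \<le> ereal (real (length ss))"
        using min_cost_le_walk_cost[of u p v "\<lambda>_. 1"] by (simp add: awalk_cost_1)
      also have "\<dots> \<le> ereal (real k)"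
        using ss(2) by simp
      finally show ?thesis .
    qed
    then show "graph_diameter (with_proj (cyclic_cayley_graph n S)) \<le> ereal (real k)"
      unfolding graph_diameter_def by (auto simp: verts intro!: SUP_least)
  next
    have "ereal (real k) \<le> \<mu> (\<lambda>_. 1) 0 (v0 mod n)"
      unfolding \<mu>_def
    proof (rule INF_greatest, clarsimp simp: awalk_cost_1)
      fix p assume "awalk 0 p (v0 mod n)"
      then obtain ss where "set ss \<subseteq> S \<union> uminus ` S" "length ss = length p"
        "[v0 mod n = sum_list ss] (mod n)"
        using steps_of_awalk[of n S 0 p "v0 mod n"] by auto
      then show "k \<le> length p"
        using lower[of ss] by (simp add: cong_def)
    qed
    also have "\<dots> \<le> graph_diameter (with_proj (cyclic_cayley_graph n S))"
      unfolding graph_diameter_def using assms(1)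
      by (intro SUP_upper2[of 0] SUP_upper2[of "v0 mod n"]) (auto simp: verts)
    finally show "ereal (real k) \<le> graph_diameter (with_proj (cyclic_cayley_graph n S))" .
  qed
qed

section \<open>The order and the generators as polynomials in \<open>m\<close>, and the lattice of
  relations\<close>

text \<open>This and the next four polynomials arise from the given fractions by substituting
  \<open>k = 5 * m + 4\<close>, after which all denominators cancel.\<close>

definition cc_order :: "int \<Rightarrow> int" where
  "cc_order m = 512 * m^5 + 2304 * m^4 + 4352 * m^3 + 4288 * m^2 + 2186 * m + 457"

definition cc_gen2 :: "int \<Rightarrow> int" where
  "cc_gen2 m = 32 * m^3 + 88 * m^2 + 92 * m + 35"

definition cc_gen3 :: "int \<Rightarrow> int" where
  "cc_gen3 m = 128 * m^4 + 448 * m^3 + 640 * m^2 + 434 * m + 116"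

definition cc_gen4 :: "int \<Rightarrow> int" where
  "cc_gen4 m = 128 * m^4 + 480 * m^3 + 720 * m^2 + 512 * m + 143"

definition cc_gen5 :: "int \<Rightarrow> int" where
  "cc_gen5 m = 256 * m^4 + 896 * m^3 + 1272 * m^2 + 850 * m + 220"

lemmas cc_defs = cc_order_def cc_gen2_def cc_gen3_def cc_gen4_def cc_gen5_def

text \<open>A homomorphism from integer vectors to integers; a relation is a vector whose value is
  divisible by \<open>cc_order m\<close>. Vectors are kept as five separate integers so that linear
  arithmetic applies directly.\<close>

definition cc_value :: "int \<Rightarrow> int \<Rightarrow> int \<Rightarrow> int \<Rightarrow> int \<Rightarrow> int \<Rightarrow> int" where
  "cc_value m x1 x2 x3 x4 x5 =
    x1 + x2 * cc_gen2 m + x3 * cc_gen3 m + x4 * cc_gen4 m + x5 * cc_gen5 m"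

text \<open>First coordinate of a general relation: \<open>a1\<close> to \<open>a5\<close> are the
  coefficients of the five rows, and \<open>b\<close> is that of the half sum
  \<open>(2*m+2, 2*m+2, 2*m+1, 2*m+2, 2*m+2)\<close>. The six coefficients are redundant, twice the
  half sum being the sum of the rows, but they treat all rows alike.\<close>

definition rel1 :: "int \<Rightarrow> int \<Rightarrow> int \<Rightarrow> int \<Rightarrow> int \<Rightarrow> int \<Rightarrow> int \<Rightarrow> int" where
  "rel1 m a1 a2 a3 a4 a5 b = (4 * m + 4) * a1 - a2 + a3 + a4 - a5 + (2 * m + 2) * b"

definition rel2 :: "int \<Rightarrow> int \<Rightarrow> int \<Rightarrow> int \<Rightarrow> int \<Rightarrow> int \<Rightarrow> int \<Rightarrow> int" where
  "rel2 m a1 a2 a3 a4 a5 b = a1 + (4 * m + 3) * a2 - a3 + a5 + (2 * m + 2) * b"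

definition rel3 :: "int \<Rightarrow> int \<Rightarrow> int \<Rightarrow> int \<Rightarrow> int \<Rightarrow> int \<Rightarrow> int \<Rightarrow> int" where
  "rel3 m a1 a2 a3 a4 a5 b = - a1 + a2 + (4 * m + 3) * a3 - a4 + (2 * m + 1) * b"

definition rel4 :: "int \<Rightarrow> int \<Rightarrow> int \<Rightarrow> int \<Rightarrow> int \<Rightarrow> int \<Rightarrow> int \<Rightarrow> int" where
  "rel4 m a1 a2 a3 a4 a5 b = - a1 + a3 + (4 * m + 4) * a4 + (2 * m + 2) * b"

definition rel5 :: "int \<Rightarrow> int \<Rightarrow> int \<Rightarrow> int \<Rightarrow> int \<Rightarrow> int \<Rightarrow> int \<Rightarrow> int" where
  "rel5 m a1 a2 a3 a4 a5 b = a1 - a2 + (4 * m + 4) * a5 + (2 * m + 2) * b"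

lemmas rel_defs = rel1_def rel2_def rel3_def rel4_def rel5_def

text \<open>The first two rows have value 0, the third and fourth \<open>cc_order m\<close>, the
  fifth twice that; the half sum has half of the total, again \<open>2 * cc_order m\<close>.\<close>

lemma cc_value_rel:
  "cc_value m (rel1 m a1 a2 a3 a4 a5 b) (rel2 m a1 a2 a3 a4 a5 b) (rel3 m a1 a2 a3 a4 a5 b)
    (rel4 m a1 a2 a3 a4 a5 b) (rel5 m a1 a2 a3 a4 a5 b) = (a3 + a4 + 2 * a5 + 2 * b) * cc_order m"
  unfolding cc_value_def rel_defs cc_defs by algebra

lemma cc_value_diff:
  "cc_value m (x1 - y1) (x2 - y2) (x3 - y3) (x4 - y4) (x5 - y5) =
    cc_value m x1 x2 x3 x4 x5 - cc_value m y1 y2 y3 y4 y5"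
  by (simp add: cc_value_def algebra_simps)

text \<open>Converse of \<open>cc_value_rel\<close>: there are no other relations. The fifth row can
  be left out, since it is twice the half sum minus the other four rows.\<close>

lemma cc_value_eq_0_cong_imp_rel:
  assumes "[cc_value m x1 x2 x3 x4 x5 = 0] (mod cc_order m)"
  obtains a1 a2 a3 a4 b where
    "x1 = rel1 m a1 a2 a3 a4 0 b" "x2 = rel2 m a1 a2 a3 a4 0 b" "x3 = rel3 m a1 a2 a3 a4 0 b"
    "x4 = rel4 m a1 a2 a3 a4 0 b" "x5 = rel5 m a1 a2 a3 a4 0 b"
proof -
  obtain c where "cc_value m x1 x2 x3 x4 x5 = cc_order m * c"
    using assms by (auto simp: cong_0_iff)
  then have x1: "x1 = c * cc_order m - (x2 * cc_gen2 m + x3 * cc_gen3 m + x4 * cc_gen4 m + x5 * cc_gen5 m)"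
    by (simp add: cc_value_def algebra_simps)
  show thesis
  proof (rule that)
    \<comment> \<open>Solution of the linear system for the coordinates in the basis of the first
      four rows and the half sum. Once \<open>x1\<close> is expressed through the quotient
      \<open>c\<close>, all coefficients of the solution are integer polynomials in
      \<open>m\<close>.\<close>
    let ?a1 = "c * (128*m^4 + 480*m^3 + 696*m^2 + 462*m + 118) - x2 * (8*m^2 + 16*m + 9)
      - x3 * (32*m^3 + 88*m^2 + 86*m + 30) - x4 * (32*m^3 + 96*m^2 + 100*m + 37)
      - x5 * (64*m^3 + 176*m^2 + 170*m + 57)"
    let ?a2 = "c * (16*m^2 + 32*m + 16) - x2 - x3 * (4*m + 4) - x4 * (4*m + 5) - x5 * (8*m + 8)"
    let ?a3 = "c * (64*m^3 + 192*m^2 + 192*m + 64) - x2 * (4*m + 5)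
      - x3 * (16*m^2 + 32*m + 16) - x4 * (16*m^2 + 36*m + 20) - x5 * (32*m^2 + 64*m + 31)"
    let ?a4 = "c * (64*m^3 + 160*m^2 + 136*m + 39) - x2 * (4*m + 3)
      - x3 * (16*m^2 + 24*m + 10) - x4 * (16*m^2 + 28*m + 12) - x5 * (32*m^2 + 48*m + 19)"
    let ?b = "x2 * (4*m + 4) + x3 * (16*m^2 + 28*m + 13) + x4 * (16*m^2 + 32*m + 16)
      + x5 * (32*m^2 + 56*m + 25) - c * (64*m^3 + 176*m^2 + 164*m + 51)"
    show "x1 = rel1 m ?a1 ?a2 ?a3 ?a4 0 ?b"
      unfolding x1 rel_defs cc_defs by algebra
    show "x2 = rel2 m ?a1 ?a2 ?a3 ?a4 0 ?b"
      unfolding rel_defs by algebra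
    show "x3 = rel3 m ?a1 ?a2 ?a3 ?a4 0 ?b"
      unfolding rel_defs by algebra
    show "x4 = rel4 m ?a1 ?a2 ?a3 ?a4 0 ?b"
      unfolding rel_defs by algebra
    show "x5 = rel5 m ?a1 ?a2 ?a3 ?a4 0 ?b"
      unfolding rel_defs by algebra
  qed
qed

section \<open>Upper bound: vectors of minimal norm, orthant by orthant\<close>

text \<open>The \<open>y\<close>s are the absolute values of the coordinates of a vector of minimal
  norm in its coset, and the \<open>s\<close>s are their signs relative to the first. Subtracting a
  relation changes the norm by the norm of the relation minus twice its overlap with the vector, so
  \<open>overlap\<close> expresses minimality. In each of the sixteen orthants a short list of
  relations forces the bound.\<close>

lemma orthant_l1_norm_le:
  fixes m y1 y2 y3 y4 y5 s2 s3 s4 s5 :: int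
  assumes m: "1 \<le> m"
    and y: "0 \<le> y1" "0 \<le> y2" "0 \<le> y3" "0 \<le> y4" "0 \<le> y5"
    and s: "s2 \<in> {1, -1}" "s3 \<in> {1, -1}" "s4 \<in> {1, -1}" "s5 \<in> {1, -1}"
    and overlap: "\<And>a1 a2 a3 a4 a5 b.
      2 * (min y1 (max 0 (rel1 m a1 a2 a3 a4 a5 b)) +
           min y2 (max 0 (s2 * rel2 m a1 a2 a3 a4 a5 b)) +
           min y3 (max 0 (s3 * rel3 m a1 a2 a3 a4 a5 b)) +
           min y4 (max 0 (s4 * rel4 m a1 a2 a3 a4 a5 b)) +
           min y5 (max 0 (s5 * rel5 m a1 a2 a3 a4 a5 b))) \<le>
      \<bar>rel1 m a1 a2 a3 a4 a5 b\<bar> + \<bar>rel2 m a1 a2 a3 a4 a5 b\<bar> + \<bar>rel3 m a1 a2 a3 a4 a5 b\<bar> +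
      \<bar>rel4 m a1 a2 a3 a4 a5 b\<bar> + \<bar>rel5 m a1 a2 a3 a4 a5 b\<bar>"
  shows "y1 + y2 + y3 + y4 + y5 \<le> 5 * m + 4"
proof -
  \<comment> \<open>With \<open>m\<close> shifted to a natural number, the simplifier can read off
    the signs of the coordinates and so evaluate \<open>max 0\<close> and the absolute
    values.\<close>
  obtain n where n: "m = 1 + int n"
    using m by (metis zle_iff_zadd)
  have n0: "0 \<le> int n"
    by simp
  \<comment> \<open>Rounding the bounds here spares \<open>smt\<close> integer rounding, on which its proof reconstruction fails.\<close>
  have half: "A \<le> N div 2" if "2 * A \<le> N" for A N :: int
    using that by linarith
  \<comment> \<open>The norm \<open>2 * k + 1\<close> equals \<open>10 * int n + 19\<close>. It is
    odd, so halving it rounds down to exactly \<open>k\<close>.\<close>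
  have [simp]: "(19 + 10 * int n) div 2 = 9 + 5 * int n" "(10 * int n + 19) div 2 = 9 + 5 * int n"
    by linarith+
  note [simp] = max_absorb1 max_absorb2 abs_of_nonneg abs_of_nonpos y[THEN min_absorb2]
  \<comment> \<open>The arguments of \<open>W\<close> are \<open>a1\<close> to \<open>a5\<close> and
    \<open>b\<close>. Instances with \<open>b = 0\<close> are single rows and combinations of two
    rows, signed to fit the orthant. Instances with \<open>b = 1\<close> are the half sum minus a
    set of rows, which reverses the signs of the coordinates in this set: one of them belongs to the
    orthant at hand, the others to nearby orthants. The other fifteen cases follow the same
    pattern.\<close>
  have ?thesis if s: "s2 = 1" "s3 = 1" "s4 = 1" "s5 = 1"
  proof -
    note W = half[OF overlap, unfolded rel_defs s n]
    have "y1 + y2 + y3 + y4 + y5 \<le> 9 + 5 * int n"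
      using y n0
       W[of 0 0 0 0 1 0, simplified] W[of 0 0 0 1 0 0, simplified] W[of 0 0 1 0 0 0, simplified]
       W[of 0 1 0 0 0 0, simplified] W[of 1 0 0 0 0 0, simplified] W[of 0 0 0 1 1 0, simplified]
       W[of 0 0 1 0 1 0, simplified] W[of 0 1 0 1 0 0, simplified] W[of 0 1 1 0 0 0, simplified]
       W[of 1 0 1 0 0 0, simplified] W[of 1 1 0 0 0 0, simplified] W[of 0 0 0 0 0 1, simplified]
       W[of "-1" 0 0 0 0 1, simplified] W[of 0 "-1" 0 0 0 1, simplified]
       W[of 0 0 "-1" 0 0 1, simplified] W[of 0 0 0 "-1" 0 1, simplified]
       W[of 0 0 0 0 "-1" 1, simplified] W[of "-1" "-1" 0 0 0 1, simplified]
       W[of "-1" 0 0 "-1" 0 1, simplified] W[of 0 "-1" 0 "-1" 0 1, simplified]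
       W[of 0 "-1" 0 0 "-1" 1, simplified] W[of 0 0 0 "-1" "-1" 1, simplified]
      by (smt (verit))
    then show ?thesis by (simp add: n)
  qed
  moreover have ?thesis if s: "s2 = 1" "s3 = 1" "s4 = 1" "s5 = -1"
  proof -
    note W = half[OF overlap, unfolded rel_defs s n]
    have "y1 + y2 + y3 + y4 + y5 \<le> 9 + 5 * int n"
      using y n0
       W[of 0 0 0 0 "-1" 0, simplified] W[of 0 0 0 1 0 0, simplified] W[of 0 0 1 0 0 0, simplified]
       W[of 0 1 0 0 0 0, simplified] W[of 1 0 0 0 0 0, simplified] W[of 0 1 0 0 "-1" 0, simplified]
       W[of 0 1 0 1 0 0, simplified] W[of 0 1 1 0 0 0, simplified] W[of 1 0 0 0 "-1" 0, simplified]
       W[of 1 0 1 0 0 0, simplified] W[of 1 1 0 0 0 0, simplified] W[of 0 0 0 0 0 1, simplified]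
       W[of "-1" 0 0 0 0 1, simplified] W[of 0 0 "-1" 0 0 1, simplified]
       W[of 0 0 0 "-1" 0 1, simplified] W[of 0 0 0 0 "-1" 1, simplified]
       W[of "-1" 0 0 0 "-1" 1, simplified] W[of 0 "-1" 0 0 "-1" 1, simplified]
       W[of 0 0 "-1" 0 "-1" 1, simplified] W[of 0 0 0 "-1" "-1" 1, simplified]
       W[of "-1" 0 "-1" 0 "-1" 1, simplified] W[of "-1" 0 0 "-1" "-1" 1, simplified]
      by (smt (verit))
    then show ?thesis by (simp add: n)
  qed
  moreover have ?thesis if s: "s2 = 1" "s3 = 1" "s4 = -1" "s5 = 1"
  proof -
    note W = half[OF overlap, unfolded rel_defs s n]
    have "y1 + y2 + y3 + y4 + y5 \<le> 9 + 5 * int n"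
      using y n0
       W[of 0 0 0 "-1" 0 0, simplified] W[of 0 0 0 0 1 0, simplified] W[of 0 0 1 0 0 0, simplified]
       W[of 0 1 0 0 0 0, simplified] W[of 1 0 0 0 0 0, simplified] W[of 0 0 1 "-1" 0 0, simplified]
       W[of 0 0 1 0 1 0, simplified] W[of 0 1 1 0 0 0, simplified] W[of 1 0 0 "-1" 0 0, simplified]
       W[of 1 0 1 0 0 0, simplified] W[of 1 1 0 0 0 0, simplified] W[of 0 0 0 0 0 1, simplified]
       W[of 0 "-1" 0 0 0 1, simplified] W[of 0 0 "-1" 0 0 1, simplified]
       W[of 0 0 0 "-1" 0 1, simplified] W[of 0 0 0 0 "-1" 1, simplified]
       W[of "-1" 0 0 "-1" 0 1, simplified] W[of 0 "-1" 0 "-1" 0 1, simplified]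
       W[of 0 0 "-1" "-1" 0 1, simplified] W[of 0 0 0 "-1" "-1" 1, simplified]
       W[of 0 "-1" "-1" "-1" 0 1, simplified] W[of 0 "-1" 0 "-1" "-1" 1, simplified]
       W[of 0 0 "-1" "-1" "-1" 1, simplified]
      by (smt (verit))
    then show ?thesis by (simp add: n)
  qed
  moreover have ?thesis if s: "s2 = 1" "s3 = 1" "s4 = -1" "s5 = -1"
  proof -
    note W = half[OF overlap, unfolded rel_defs s n]
    have "y1 + y2 + y3 + y4 + y5 \<le> 9 + 5 * int n"
      using y n0
       W[of 0 0 0 "-1" 0 0, simplified] W[of 0 0 0 0 "-1" 0, simplified]
       W[of 0 0 1 0 0 0, simplified] W[of 0 1 0 0 0 0, simplified] W[of 1 0 0 0 0 0, simplified]
       W[of 0 0 0 "-1" "-1" 0, simplified] W[of 0 0 1 "-1" 0 0, simplified]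
       W[of 0 1 0 0 "-1" 0, simplified] W[of 0 1 1 0 0 0, simplified]
       W[of 1 0 0 "-1" 0 0, simplified] W[of 1 0 0 0 "-1" 0, simplified]
       W[of 1 0 1 0 0 0, simplified] W[of 1 1 0 0 0 0, simplified] W[of 0 0 0 0 0 1, simplified]
       W[of 0 0 0 "-1" 0 1, simplified] W[of 0 0 0 0 "-1" 1, simplified]
       W[of "-1" 0 0 "-1" 0 1, simplified] W[of 0 "-1" 0 0 "-1" 1, simplified]
       W[of 0 0 "-1" "-1" 0 1, simplified] W[of 0 0 "-1" 0 "-1" 1, simplified]
       W[of 0 0 0 "-1" "-1" 1, simplified] W[of "-1" 0 0 "-1" "-1" 1, simplified]
       W[of 0 "-1" 0 "-1" "-1" 1, simplified] W[of 0 0 "-1" "-1" "-1" 1, simplified]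
       W[of "-1" 0 "-1" "-1" "-1" 1, simplified] W[of 0 "-1" "-1" "-1" "-1" 1, simplified]
      by (smt (verit))
    then show ?thesis by (simp add: n)
  qed
  moreover have ?thesis if s: "s2 = 1" "s3 = -1" "s4 = 1" "s5 = 1"
  proof -
    note W = half[OF overlap, unfolded rel_defs s n]
    have "y1 + y2 + y3 + y4 + y5 \<le> 9 + 5 * int n"
      using y n0
       W[of 0 0 "-1" 0 0 0, simplified] W[of 0 0 0 0 1 0, simplified] W[of 0 0 0 1 0 0, simplified]
       W[of 0 1 0 0 0 0, simplified] W[of 1 0 0 0 0 0, simplified] W[of 0 0 "-1" 1 0 0, simplified]
       W[of 0 0 0 1 1 0, simplified] W[of 0 1 0 1 0 0, simplified] W[of 1 1 0 0 0 0, simplified]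
       W[of 0 0 0 0 0 1, simplified] W[of "-1" 0 0 0 0 1, simplified]
       W[of 0 "-1" 0 0 0 1, simplified] W[of 0 0 "-1" 0 0 1, simplified]
       W[of 0 0 0 0 "-1" 1, simplified] W[of "-1" 0 "-1" 0 0 1, simplified]
       W[of 0 "-1" "-1" 0 0 1, simplified] W[of 0 "-1" 0 0 "-1" 1, simplified]
       W[of 0 0 "-1" 0 "-1" 1, simplified] W[of "-1" "-1" "-1" 0 0 1, simplified]
       W[of 0 "-1" "-1" 0 "-1" 1, simplified]
      by (smt (verit))
    then show ?thesis by (simp add: n)
  qed
  moreover have ?thesis if s: "s2 = 1" "s3 = -1" "s4 = 1" "s5 = -1"
  proof -
    note W = half[OF overlap, unfolded rel_defs s n]
    have "y1 + y2 + y3 + y4 + y5 \<le> 9 + 5 * int n"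
      using y n0
       W[of 0 0 "-1" 0 0 0, simplified] W[of 0 0 0 0 "-1" 0, simplified]
       W[of 0 0 0 1 0 0, simplified] W[of 0 1 0 0 0 0, simplified] W[of 1 0 0 0 0 0, simplified]
       W[of 0 0 "-1" 0 "-1" 0, simplified] W[of 0 0 "-1" 1 0 0, simplified]
       W[of 0 1 0 0 "-1" 0, simplified] W[of 0 1 0 1 0 0, simplified]
       W[of 1 0 0 0 "-1" 0, simplified] W[of 1 1 0 0 0 0, simplified] W[of 0 0 0 0 0 1, simplified]
       W[of 0 0 "-1" 0 0 1, simplified] W[of 0 0 0 0 "-1" 1, simplified]
       W[of "-1" 0 "-1" 0 0 1, simplified] W[of "-1" 0 0 0 "-1" 1, simplified]
       W[of 0 "-1" 0 0 "-1" 1, simplified] W[of 0 0 "-1" 0 "-1" 1, simplified]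
       W[of "-1" 0 "-1" 0 "-1" 1, simplified] W[of 0 "-1" "-1" 0 "-1" 1, simplified]
       W[of "-1" "-1" "-1" 0 "-1" 1, simplified]
      by (smt (verit))
    then show ?thesis by (simp add: n)
  qed
  moreover have ?thesis if s: "s2 = 1" "s3 = -1" "s4 = -1" "s5 = 1"
  proof -
    note W = half[OF overlap, unfolded rel_defs s n]
    have "y1 + y2 + y3 + y4 + y5 \<le> 9 + 5 * int n"
      using y n0
       W[of 0 0 "-1" 0 0 0, simplified] W[of 0 0 0 "-1" 0 0, simplified]
       W[of 0 0 0 0 1 0, simplified] W[of 0 1 0 0 0 0, simplified] W[of 1 0 0 0 0 0, simplified]
       W[of 1 0 0 "-1" 0 0, simplified] W[of 1 1 0 0 0 0, simplified] W[of 0 0 0 0 0 1, simplified]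
       W[of 0 "-1" 0 0 0 1, simplified] W[of 0 0 "-1" 0 0 1, simplified]
       W[of 0 0 0 "-1" 0 1, simplified] W[of 0 "-1" "-1" 0 0 1, simplified]
       W[of 0 "-1" 0 "-1" 0 1, simplified] W[of 0 0 "-1" "-1" 0 1, simplified]
       W[of 0 0 "-1" 0 "-1" 1, simplified] W[of 0 0 0 "-1" "-1" 1, simplified]
       W[of 0 "-1" "-1" "-1" 0 1, simplified] W[of 0 "-1" "-1" 0 "-1" 1, simplified]
       W[of 0 0 "-1" "-1" "-1" 1, simplified] W[of 0 "-1" "-1" "-1" "-1" 1, simplified]
      by (smt (verit))
    then show ?thesis by (simp add: n)
  qed
  moreover have ?thesis if s: "s2 = 1" "s3 = -1" "s4 = -1" "s5 = -1"
  proof -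
    note W = half[OF overlap, unfolded rel_defs s n]
    have "y1 + y2 + y3 + y4 + y5 \<le> 9 + 5 * int n"
      using y n0
       W[of 0 0 "-1" 0 0 0, simplified] W[of 0 0 0 "-1" 0 0, simplified]
       W[of 0 0 0 0 "-1" 0, simplified] W[of 0 1 0 0 0 0, simplified] W[of 1 0 0 0 0 0, simplified]
       W[of 0 0 "-1" 0 "-1" 0, simplified] W[of 0 0 0 "-1" "-1" 0, simplified]
       W[of 0 1 0 0 "-1" 0, simplified] W[of 1 0 0 "-1" 0 0, simplified]
       W[of 1 0 0 0 "-1" 0, simplified] W[of 1 1 0 0 0 0, simplified]
       W[of 0 0 "-1" 0 0 1, simplified] W[of 0 0 0 0 "-1" 1, simplified]
       W[of 0 0 "-1" "-1" 0 1, simplified] W[of 0 0 "-1" 0 "-1" 1, simplified]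
       W[of 0 0 0 "-1" "-1" 1, simplified] W[of "-1" 0 "-1" 0 "-1" 1, simplified]
       W[of 0 "-1" "-1" 0 "-1" 1, simplified] W[of 0 "-1" 0 "-1" "-1" 1, simplified]
       W[of 0 0 "-1" "-1" "-1" 1, simplified] W[of "-1" 0 "-1" "-1" "-1" 1, simplified]
       W[of 0 "-1" "-1" "-1" "-1" 1, simplified]
      by (smt (verit))
    then show ?thesis by (simp add: n)
  qed
  moreover have ?thesis if s: "s2 = -1" "s3 = 1" "s4 = 1" "s5 = 1"
  proof -
    note W = half[OF overlap, unfolded rel_defs s n]
    have "y1 + y2 + y3 + y4 + y5 \<le> 9 + 5 * int n"
      using y n0
       W[of 0 "-1" 0 0 0 0, simplified] W[of 0 0 0 0 1 0, simplified] W[of 0 0 0 1 0 0, simplified]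
       W[of 0 0 1 0 0 0, simplified] W[of 1 0 0 0 0 0, simplified] W[of 0 "-1" 0 0 1 0, simplified]
       W[of 0 0 0 1 1 0, simplified] W[of 0 0 1 0 1 0, simplified] W[of 1 0 1 0 0 0, simplified]
       W[of 0 0 0 0 0 1, simplified] W[of "-1" 0 0 0 0 1, simplified]
       W[of 0 "-1" 0 0 0 1, simplified] W[of 0 0 0 "-1" 0 1, simplified]
       W[of 0 0 0 0 "-1" 1, simplified] W[of "-1" "-1" 0 0 0 1, simplified]
       W[of 0 "-1" 0 "-1" 0 1, simplified] W[of 0 "-1" 0 0 "-1" 1, simplified]
       W[of "-1" "-1" 0 "-1" 0 1, simplified] W[of "-1" "-1" 0 0 "-1" 1, simplified]
       W[of 0 "-1" 0 "-1" "-1" 1, simplified]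
      by (smt (verit))
    then show ?thesis by (simp add: n)
  qed
  moreover have ?thesis if s: "s2 = -1" "s3 = 1" "s4 = 1" "s5 = -1"
  proof -
    note W = half[OF overlap, unfolded rel_defs s n]
    have "y1 + y2 + y3 + y4 + y5 \<le> 9 + 5 * int n"
      using y n0
       W[of 0 "-1" 0 0 0 0, simplified] W[of 0 0 0 0 "-1" 0, simplified]
       W[of 0 0 0 1 0 0, simplified] W[of 0 0 1 0 0 0, simplified] W[of 1 0 0 0 0 0, simplified]
       W[of 1 0 0 0 "-1" 0, simplified] W[of 1 0 1 0 0 0, simplified]
       W[of 0 0 0 0 "-1" 1, simplified] W[of "-1" 0 0 0 "-1" 1, simplified]
       W[of 0 "-1" 0 0 "-1" 1, simplified] W[of 0 0 0 "-1" "-1" 1, simplified]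
       W[of "-1" "-1" 0 0 "-1" 1, simplified] W[of "-1" 0 0 "-1" "-1" 1, simplified]
       W[of 0 "-1" 0 "-1" "-1" 1, simplified] W[of "-1" "-1" 0 "-1" "-1" 1, simplified]
      by (smt (verit))
    then show ?thesis by (simp add: n)
  qed
  moreover have ?thesis if s: "s2 = -1" "s3 = 1" "s4 = -1" "s5 = 1"
  proof -
    note W = half[OF overlap, unfolded rel_defs s n]
    have "y1 + y2 + y3 + y4 + y5 \<le> 9 + 5 * int n"
      using y n0
       W[of 0 "-1" 0 0 0 0, simplified] W[of 0 0 0 "-1" 0 0, simplified]
       W[of 0 0 0 0 1 0, simplified] W[of 0 0 1 0 0 0, simplified] W[of 1 0 0 0 0 0, simplified]
       W[of 0 "-1" 0 "-1" 0 0, simplified] W[of 0 "-1" 0 0 1 0, simplified]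
       W[of 0 0 1 "-1" 0 0, simplified] W[of 0 0 1 0 1 0, simplified]
       W[of 1 0 0 "-1" 0 0, simplified] W[of 1 0 1 0 0 0, simplified]
       W[of 0 "-1" 0 0 0 1, simplified] W[of 0 0 0 "-1" 0 1, simplified]
       W[of "-1" 0 0 "-1" 0 1, simplified] W[of 0 "-1" 0 "-1" 0 1, simplified]
       W[of 0 "-1" 0 0 "-1" 1, simplified] W[of 0 0 0 "-1" "-1" 1, simplified]
       W[of "-1" "-1" 0 "-1" 0 1, simplified] W[of 0 "-1" "-1" "-1" 0 1, simplified]
       W[of 0 "-1" 0 "-1" "-1" 1, simplified] W[of "-1" "-1" 0 "-1" "-1" 1, simplified]
       W[of 0 "-1" "-1" "-1" "-1" 1, simplified]
      by (smt (verit))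
    then show ?thesis by (simp add: n)
  qed
  moreover have ?thesis if s: "s2 = -1" "s3 = 1" "s4 = -1" "s5 = -1"
  proof -
    note W = half[OF overlap, unfolded rel_defs s n]
    have "y1 + y2 + y3 + y4 + y5 \<le> 9 + 5 * int n"
      using y n0
       W[of 0 "-1" 0 0 0 0, simplified] W[of 0 0 0 "-1" 0 0, simplified]
       W[of 0 0 0 0 "-1" 0, simplified] W[of 0 0 1 0 0 0, simplified] W[of 1 0 0 0 0 0, simplified]
       W[of 0 "-1" 0 "-1" 0 0, simplified] W[of 0 0 0 "-1" "-1" 0, simplified]
       W[of 0 0 1 "-1" 0 0, simplified] W[of 1 0 0 "-1" 0 0, simplified]
       W[of 1 0 0 0 "-1" 0, simplified] W[of 1 0 1 0 0 0, simplified]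
       W[of 0 0 0 0 "-1" 1, simplified] W[of 0 "-1" 0 0 "-1" 1, simplified]
       W[of 0 0 0 "-1" "-1" 1, simplified] W[of "-1" 0 0 "-1" "-1" 1, simplified]
       W[of 0 "-1" 0 "-1" "-1" 1, simplified] W[of 0 0 "-1" "-1" "-1" 1, simplified]
       W[of "-1" "-1" 0 "-1" "-1" 1, simplified] W[of 0 "-1" "-1" "-1" "-1" 1, simplified]
       W[of "-1" "-1" "-1" "-1" "-1" 1, simplified]
      by (smt (verit))
    then show ?thesis by (simp add: n)
  qed
  moreover have ?thesis if s: "s2 = -1" "s3 = -1" "s4 = 1" "s5 = 1"
  proof -
    note W = half[OF overlap, unfolded rel_defs s n]
    have "y1 + y2 + y3 + y4 + y5 \<le> 9 + 5 * int n"
      using y n0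
       W[of 0 "-1" 0 0 0 0, simplified] W[of 0 0 "-1" 0 0 0, simplified]
       W[of 0 0 0 0 1 0, simplified] W[of 0 0 0 1 0 0, simplified] W[of 1 0 0 0 0 0, simplified]
       W[of 0 "-1" "-1" 0 0 0, simplified] W[of 0 "-1" 0 0 1 0, simplified]
       W[of 0 0 "-1" 1 0 0, simplified] W[of 0 0 0 1 1 0, simplified]
       W[of 0 "-1" 0 0 0 1, simplified] W[of "-1" "-1" 0 0 0 1, simplified]
       W[of 0 "-1" "-1" 0 0 1, simplified] W[of 0 "-1" 0 0 "-1" 1, simplified]
       W[of "-1" "-1" "-1" 0 0 1, simplified] W[of "-1" "-1" 0 0 "-1" 1, simplified]
       W[of 0 "-1" "-1" 0 "-1" 1, simplified] W[of "-1" "-1" "-1" 0 "-1" 1, simplified]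
      by (smt (verit))
    then show ?thesis by (simp add: n)
  qed
  moreover have ?thesis if s: "s2 = -1" "s3 = -1" "s4 = 1" "s5 = -1"
  proof -
    note W = half[OF overlap, unfolded rel_defs s n]
    have "y1 + y2 + y3 + y4 + y5 \<le> 9 + 5 * int n"
      using y n0
       W[of 0 "-1" 0 0 0 0, simplified] W[of 0 0 "-1" 0 0 0, simplified]
       W[of 0 0 0 0 "-1" 0, simplified] W[of 0 0 0 1 0 0, simplified] W[of 1 0 0 0 0 0, simplified]
       W[of 0 "-1" "-1" 0 0 0, simplified] W[of 0 0 "-1" 0 "-1" 0, simplified]
       W[of 0 0 "-1" 1 0 0, simplified] W[of 1 0 0 0 "-1" 0, simplified]
       W[of 0 0 0 0 "-1" 1, simplified] W[of "-1" 0 0 0 "-1" 1, simplified]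
       W[of 0 "-1" 0 0 "-1" 1, simplified] W[of 0 0 "-1" 0 "-1" 1, simplified]
       W[of "-1" "-1" 0 0 "-1" 1, simplified] W[of "-1" 0 "-1" 0 "-1" 1, simplified]
       W[of 0 "-1" "-1" 0 "-1" 1, simplified] W[of "-1" "-1" "-1" 0 "-1" 1, simplified]
      by (smt (verit))
    then show ?thesis by (simp add: n)
  qed
  moreover have ?thesis if s: "s2 = -1" "s3 = -1" "s4 = -1" "s5 = 1"
  proof -
    note W = half[OF overlap, unfolded rel_defs s n]
    have "y1 + y2 + y3 + y4 + y5 \<le> 9 + 5 * int n"
      using y n0
       W[of 0 "-1" 0 0 0 0, simplified] W[of 0 0 "-1" 0 0 0, simplified]
       W[of 0 0 0 "-1" 0 0, simplified] W[of 0 0 0 0 1 0, simplified] W[of 1 0 0 0 0 0, simplified]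
       W[of 0 "-1" "-1" 0 0 0, simplified] W[of 0 "-1" 0 "-1" 0 0, simplified]
       W[of 0 "-1" 0 0 1 0, simplified] W[of 1 0 0 "-1" 0 0, simplified]
       W[of 0 "-1" 0 0 0 1, simplified] W[of 0 "-1" "-1" 0 0 1, simplified]
       W[of 0 "-1" 0 "-1" 0 1, simplified] W[of 0 "-1" 0 0 "-1" 1, simplified]
       W[of "-1" "-1" "-1" 0 0 1, simplified] W[of "-1" "-1" 0 "-1" 0 1, simplified]
       W[of 0 "-1" "-1" "-1" 0 1, simplified] W[of 0 "-1" "-1" 0 "-1" 1, simplified]
       W[of 0 "-1" 0 "-1" "-1" 1, simplified] W[of "-1" "-1" "-1" "-1" 0 1, simplified]
       W[of 0 "-1" "-1" "-1" "-1" 1, simplified] W[of "-1" "-1" "-1" "-1" "-1" 1, simplified]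
      by (smt (verit))
    then show ?thesis by (simp add: n)
  qed
  moreover have ?thesis if s: "s2 = -1" "s3 = -1" "s4 = -1" "s5 = -1"
  proof -
    note W = half[OF overlap, unfolded rel_defs s n]
    have "y1 + y2 + y3 + y4 + y5 \<le> 9 + 5 * int n"
      using y n0
       W[of 0 "-1" 0 0 0 0, simplified] W[of 0 0 "-1" 0 0 0, simplified]
       W[of 0 0 0 "-1" 0 0, simplified] W[of 0 0 0 0 "-1" 0, simplified]
       W[of 1 0 0 0 0 0, simplified] W[of 0 "-1" "-1" 0 0 0, simplified]
       W[of 0 "-1" 0 "-1" 0 0, simplified] W[of 0 0 "-1" 0 "-1" 0, simplified]
       W[of 0 0 0 "-1" "-1" 0, simplified] W[of 1 0 0 "-1" 0 0, simplified]
       W[of 1 0 0 0 "-1" 0, simplified] W[of 0 "-1" 0 0 "-1" 1, simplified]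
       W[of 0 0 "-1" 0 "-1" 1, simplified] W[of 0 0 0 "-1" "-1" 1, simplified]
       W[of 0 "-1" "-1" 0 "-1" 1, simplified] W[of 0 "-1" 0 "-1" "-1" 1, simplified]
       W[of 0 0 "-1" "-1" "-1" 1, simplified] W[of "-1" "-1" "-1" 0 "-1" 1, simplified]
       W[of "-1" "-1" 0 "-1" "-1" 1, simplified] W[of "-1" 0 "-1" "-1" "-1" 1, simplified]
       W[of 0 "-1" "-1" "-1" "-1" 1, simplified] W[of "-1" "-1" "-1" "-1" "-1" 1, simplified]
      by (smt (verit))
    then show ?thesis by (simp add: n)
  qed
  moreover note orthants = calculation
  show ?thesis
    using s by (elim insertE emptyE) (rule orthants; assumption)+
qed

section \<open>Lower bound: a vector that is far from all relations\<close>

text \<open>Four times the vector \<open>(m+1, m+1, m, m+1, m+1)\<close> is the sum of the rows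
  minus 2 in the third coordinate. Four times its translate by a relation is thus the combination of
  the rows with coefficients \<open>d1\<close> to \<open>d5\<close>, with the same correction. These
  coefficients are odd and congruent to each other modulo 4. If all are 1, the norm is
  \<open>5 * m + 4\<close>; if all are -1, it is \<open>5 * m + 5\<close>; otherwise diagonal
  dominance takes over.\<close>

lemma hole_l1_norm_ge:
  fixes m a1 a2 a3 a4 a5 b :: int
  assumes "1 \<le> m"
  shows "5 * m + 4 \<le> \<bar>m + 1 + rel1 m a1 a2 a3 a4 a5 b\<bar> + \<bar>m + 1 + rel2 m a1 a2 a3 a4 a5 b\<bar> +
    \<bar>m + rel3 m a1 a2 a3 a4 a5 b\<bar> + \<bar>m + 1 + rel4 m a1 a2 a3 a4 a5 b\<bar> + \<bar>m + 1 + rel5 m a1 a2 a3 a4 a5 b\<bar>"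
    (is "_ \<le> ?N")
proof -
  define d1 d2 d3 d4 d5 where d_defs: "d1 = 4 * a1 + 2 * b + 1" "d2 = 4 * a2 + 2 * b + 1" 
    "d3 = 4 * a3 + 2 * b + 1" "d4 = 4 * a4 + 2 * b + 1" "d5 = 4 * a5 + 2 * b + 1"
  define p1 p2 p3 p4 p5 where p_defs: "p1 = (4 * m + 4) * d1" "p2 = (4 * m + 3) * d2"
    "p3 = (4 * m + 3) * d3" "p4 = (4 * m + 4) * d4" "p5 = (4 * m + 4) * d5"
  have y: "4 * (m + 1 + rel1 m a1 a2 a3 a4 a5 b) = p1 - d2 + d3 + d4 - d5"
    "4 * (m + 1 + rel2 m a1 a2 a3 a4 a5 b) = d1 + p2 - d3 + d5"
    "4 * (m + rel3 m a1 a2 a3 a4 a5 b) = - d1 + d2 + p3 - d4 - 2"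
    "4 * (m + 1 + rel4 m a1 a2 a3 a4 a5 b) = - d1 + d3 + p4"
    "4 * (m + 1 + rel5 m a1 a2 a3 a4 a5 b) = d1 - d2 + p5"
    by (simp_all add: rel_defs p_defs d_defs algebra_simps)
  have odd: "1 \<le> \<bar>d1\<bar>" "1 \<le> \<bar>d2\<bar>" "1 \<le> \<bar>d3\<bar>" "1 \<le> \<bar>d4\<bar>" "1 \<le> \<bar>d5\<bar>"
    unfolding d_defs by presburger+
  have small: "d1 = 1 \<or> d1 = -1 \<or> 3 \<le> \<bar>d1\<bar>" "d2 = 1 \<or> d2 = -1 \<or> 3 \<le> \<bar>d2\<bar>"
    "d3 = 1 \<or> d3 = -1 \<or> 3 \<le> \<bar>d3\<bar>" "d4 = 1 \<or> d4 = -1 \<or> 3 \<le> \<bar>d4\<bar>"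
    "d5 = 1 \<or> d5 = -1 \<or> 3 \<le> \<bar>d5\<bar>"
    unfolding d_defs by presburger+
  have same: "\<bar>d1 - d2\<bar> \<noteq> 2" "\<bar>d1 - d3\<bar> \<noteq> 2" "\<bar>d1 - d4\<bar> \<noteq> 2" "\<bar>d1 - d5\<bar> \<noteq> 2"
    unfolding d_defs by presburger+
  \<comment> \<open>If every absolute value is 1, congruence modulo 4 makes the signs agree;
    otherwise one of them is at least 3 and the sum is at least 3 + 4.\<close>
  consider "d1 = 1" "d2 = 1" "d3 = 1" "d4 = 1" "d5 = 1"
    | "d1 = -1" "d2 = -1" "d3 = -1" "d4 = -1" "d5 = -1"
    | "7 \<le> \<bar>d1\<bar> + \<bar>d2\<bar> + \<bar>d3\<bar> + \<bar>d4\<bar> + \<bar>d5\<bar>"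
    using odd small same by (smt (verit))
  then show ?thesis
  proof cases
    case 1
    then show ?thesis using y assms by (simp add: p_defs)
  next
    case 2
    then show ?thesis using y assms by (simp add: p_defs)
  next
    case 3
    have mult: "\<bar>(4 * m + c) * d\<bar> = 4 * (m * \<bar>d\<bar>) + c * \<bar>d\<bar>" if "0 \<le> c" for c d
      unfolding abs_mult using assms that by (simp add: distrib_right)
    have p: "\<bar>p1\<bar> = 4 * (m * \<bar>d1\<bar>) + 4 * \<bar>d1\<bar>" "\<bar>p2\<bar> = 4 * (m * \<bar>d2\<bar>) + 3 * \<bar>d2\<bar>"
      "\<bar>p3\<bar> = 4 * (m * \<bar>d3\<bar>) + 3 * \<bar>d3\<bar>" "\<bar>p4\<bar> = 4 * (m * \<bar>d4\<bar>) + 4 * \<bar>d4\<bar>"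
      "\<bar>p5\<bar> = 4 * (m * \<bar>d5\<bar>) + 4 * \<bar>d5\<bar>"
      unfolding p_defs by (rule mult, simp)+
    have "m * 7 \<le> m * (\<bar>d1\<bar> + \<bar>d2\<bar> + \<bar>d3\<bar> + \<bar>d4\<bar> + \<bar>d5\<bar>)"
      using 3 assms by (intro mult_left_mono) auto
    then have *: "7 * m \<le> m * \<bar>d1\<bar> + m * \<bar>d2\<bar> + m * \<bar>d3\<bar> + m * \<bar>d4\<bar> + m * \<bar>d5\<bar>"
      by (simp add: algebra_simps)
    have "\<bar>p1\<bar> \<le> 4 * \<bar>m + 1 + rel1 m a1 a2 a3 a4 a5 b\<bar> + \<bar>d2\<bar> + \<bar>d3\<bar> + \<bar>d4\<bar> + \<bar>d5\<bar>"
      "\<bar>p2\<bar> \<le> 4 * \<bar>m + 1 + rel2 m a1 a2 a3 a4 a5 b\<bar> + \<bar>d1\<bar> + \<bar>d3\<bar> + \<bar>d5\<bar>"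
      "\<bar>p3\<bar> \<le> 4 * \<bar>m + rel3 m a1 a2 a3 a4 a5 b\<bar> + \<bar>d1\<bar> + \<bar>d2\<bar> + \<bar>d4\<bar> + 2"
      "\<bar>p4\<bar> \<le> 4 * \<bar>m + 1 + rel4 m a1 a2 a3 a4 a5 b\<bar> + \<bar>d1\<bar> + \<bar>d3\<bar>"
      "\<bar>p5\<bar> \<le> 4 * \<bar>m + 1 + rel5 m a1 a2 a3 a4 a5 b\<bar> + \<bar>d1\<bar> + \<bar>d2\<bar>"
      using y by (smt (verit))+
    \<comment> \<open>Summation of the five estimates. The rows have 4, 3, 3, 2 and 2 nonzero
      off-diagonal entries, which leaves the factors \<open>4 * m\<close> for the first three and
      \<open>4 * m + 2\<close> for the last two.\<close>
    then have bound: "4 * (m * \<bar>d1\<bar> + m * \<bar>d2\<bar> + m * \<bar>d3\<bar> + m * \<bar>d4\<bar> + m * \<bar>d5\<bar>)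
        + 2 * \<bar>d4\<bar> + 2 * \<bar>d5\<bar> \<le> 4 * ?N + 2"
      unfolding p by (smt (verit))
    show ?thesis
    \<comment> \<open>With \<open>*\<close> and \<open>odd\<close>, \<open>bound\<close> yields a
      norm of at least \<open>7 * m + 1\<close>. This suffices from \<open>m = 2\<close> on, but for
      \<open>m = 1\<close> it gives 8 instead of 9.\<close>
    proof (cases "m = 1")
      case True
      show ?thesis
      proof (rule ccontr)
        \<comment> \<open>For a norm of at most 8, \<open>bound\<close> leaves only absolute values
          with sum 7: one is 3, the others are 1, and congruence modulo 4 gives the 3 the opposite
          sign. These ten vectors are checked directly.\<close>
        let ?D = "{(-3,1,1,1,1), (1,-3,1,1,1), (1,1,-3,1,1), (1,1,1,-3,1), (1,1,1,1,-3),
            (3,-1,-1,-1,-1), (-1,3,-1,-1,-1), (-1,-1,3,-1,-1), (-1,-1,-1,3,-1), (-1,-1,-1,-1,3)}"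
        assume N: "\<not> ?thesis"
        then have sum: "\<bar>d1\<bar> + \<bar>d2\<bar> + \<bar>d3\<bar> + \<bar>d4\<bar> + \<bar>d5\<bar> \<le> 7"
          using bound odd unfolding True by (smt (verit))
        then have D: "(d1, d2, d3, d4, d5) \<in> ?D"
          using 3 odd small same unfolding insert_iff prod.inject by (smt (verit))
        have "9 \<le> \<bar>y1\<bar> + \<bar>y2\<bar> + \<bar>y3\<bar> + \<bar>y4\<bar> + \<bar>y5\<bar>"
          if "4 * y1 = p1 - d2 + d3 + d4 - d5" "4 * y2 = d1 + p2 - d3 + d5"
            "4 * y3 = - d1 + d2 + p3 - d4 - 2" "4 * y4 = - d1 + d3 + p4" "4 * y5 = d1 - d2 + p5"
          for y1 y2 y3 y4 y5
          using that D unfolding p_defs True by auto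
        from this[OF y] N show False
          unfolding True by simp
      qed
    next
      case False
      then show ?thesis using assms * bound odd by (smt (verit))
    qed
  qed
qed

text \<open>For \<open>m = 0\<close> the rows give no useful dominance, and the claim is a finite
  check modulo 457. Here 399 is the value of \<open>(1, 1, 0, 1, 1)\<close>, and \<open>?r\<close>
  is the largest absolute value of \<open>y1\<close> that keeps the norm within 3. A counterexample
  would put \<open>?r + y1\<close> between 0 and \<open>2 * ?r\<close>, which \<open>check\<close>
  excludes for its residue.\<close>

lemma hole_l1_norm_ge_0:
  assumes "[cc_value 0 y1 y2 y3 y4 y5 = cc_value 0 1 1 0 1 1] (mod cc_order 0)"
  shows "4 \<le> \<bar>y1\<bar> + \<bar>y2\<bar> + \<bar>y3\<bar> + \<bar>y4\<bar> + \<bar>y5\<bar>"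
proof (rule ccontr)
  let ?r = "\<lambda>y2 y3 y4 y5. 3 - (\<bar>y2\<bar> + \<bar>y3\<bar> + \<bar>y4\<bar> + \<bar>y5\<bar> :: int)"
  have check: "\<forall>y2\<in>set [-3..3]. \<forall>y3\<in>set [-3..3]. \<forall>y4\<in>set [-3..3]. \<forall>y5\<in>set [-3..3].
    0 \<le> ?r y2 y3 y4 y5 \<longrightarrow>
    2 * ?r y2 y3 y4 y5 < (399 + ?r y2 y3 y4 y5 - 35 * y2 - 116 * y3 - 143 * y4 - 220 * y5) mod 457"
    by code_simp
  assume small: "\<not> ?thesis"
  then have "y2 \<in> set [-3..3]" "y3 \<in> set [-3..3]" "y4 \<in> set [-3..3]" "y5 \<in> set [-3..3]"
    by auto
  with check small have *: "2 * ?r y2 y3 y4 y5 <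
      (399 + ?r y2 y3 y4 y5 - 35 * y2 - 116 * y3 - 143 * y4 - 220 * y5) mod 457"
    by (smt (verit))
  have "[399 + ?r y2 y3 y4 y5 - 35 * y2 - 116 * y3 - 143 * y4 - 220 * y5 = ?r y2 y3 y4 y5 + y1] (mod 457)"
    using assms by (simp add: cc_value_def cc_defs cong_iff_dvd_diff algebra_simps) presburger
  moreover have "0 \<le> ?r y2 y3 y4 y5 + y1" "?r y2 y3 y4 y5 + y1 < 457" "?r y2 y3 y4 y5 + y1 \<le> 2 * ?r y2 y3 y4 y5"
    using small by (smt (verit))+
  ultimately show False using * by (simp add: cong_def)
qed

section \<open>Upper bound: short representatives of all residues\<close>

text \<open>A representative of minimal norm satisfies the overlap inequalities of
  \<open>orthant_l1_norm_le\<close>. As relations are closed under negation, multiplying them by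
  \<open>s1\<close> normalizes the first sign to 1.\<close>

lemma exists_short_rep:
  fixes m v :: int
  assumes "1 \<le> m"
  shows "\<exists>x1 x2 x3 x4 x5. [cc_value m x1 x2 x3 x4 x5 = v] (mod cc_order m) \<and>
    \<bar>x1\<bar> + \<bar>x2\<bar> + \<bar>x3\<bar> + \<bar>x4\<bar> + \<bar>x5\<bar> \<le> 5 * m + 4"
proof -
  define P where "P = (\<lambda>(x1, x2, x3, x4, x5). [cc_value m x1 x2 x3 x4 x5 = v] (mod cc_order m))"
  define f where "f = (\<lambda>(x1, x2, x3, x4, x5). nat (\<bar>x1\<bar> + \<bar>x2\<bar> + \<bar>x3\<bar> + \<bar>x4\<bar> + \<bar>x5 :: int\<bar>))"
  have "P (v, 0, 0, 0, 0)"
    by (simp add: P_def cc_value_def)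
  then obtain x where "P x" and least: "\<And>y. P y \<Longrightarrow> f x \<le> f y"
    using ex_has_least_nat[of P _ f] by blast
  obtain x1 x2 x3 x4 x5 where x: "x = (x1, x2, x3, x4, x5)"
    by (cases x)
  have rep: "[cc_value m x1 x2 x3 x4 x5 = v] (mod cc_order m)"
    using \<open>P x\<close> by (simp add: P_def x)
  \<comment> \<open>A coordinate 0 gets the sign 1; the choice is immaterial, as its overlap with
    any relation is 0.\<close>
  define s1 s2 s3 s4 s5 :: int where s_defs:
    "s1 = (if 0 \<le> x1 then 1 else -1)" "s2 = (if 0 \<le> x2 then 1 else -1)"
    "s3 = (if 0 \<le> x3 then 1 else -1)" "s4 = (if 0 \<le> x4 then 1 else -1)"
    "s5 = (if 0 \<le> x5 then 1 else -1)"
  have s: "s1 \<in> {1, -1}" "s2 \<in> {1, -1}" "s3 \<in> {1, -1}" "s4 \<in> {1, -1}" "s5 \<in> {1, -1}"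
    by (simp_all add: s_defs)
  have overlap: "2 * (min \<bar>x1\<bar> (max 0 (rel1 m a1 a2 a3 a4 a5 b)) +
      min \<bar>x2\<bar> (max 0 (s1 * s2 * rel2 m a1 a2 a3 a4 a5 b)) +
      min \<bar>x3\<bar> (max 0 (s1 * s3 * rel3 m a1 a2 a3 a4 a5 b)) +
      min \<bar>x4\<bar> (max 0 (s1 * s4 * rel4 m a1 a2 a3 a4 a5 b)) +
      min \<bar>x5\<bar> (max 0 (s1 * s5 * rel5 m a1 a2 a3 a4 a5 b))) \<le>
      \<bar>rel1 m a1 a2 a3 a4 a5 b\<bar> + \<bar>rel2 m a1 a2 a3 a4 a5 b\<bar> + \<bar>rel3 m a1 a2 a3 a4 a5 b\<bar> +
      \<bar>rel4 m a1 a2 a3 a4 a5 b\<bar> + \<bar>rel5 m a1 a2 a3 a4 a5 b\<bar>" for a1 a2 a3 a4 a5 b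
  proof -
    define r1 r2 r3 r4 r5 where r_defs:
      "r1 = rel1 m a1 a2 a3 a4 a5 b" "r2 = rel2 m a1 a2 a3 a4 a5 b" "r3 = rel3 m a1 a2 a3 a4 a5 b"
      "r4 = rel4 m a1 a2 a3 a4 a5 b" "r5 = rel5 m a1 a2 a3 a4 a5 b"
    have "cc_value m (s1 * r1) (s1 * r2) (s1 * r3) (s1 * r4) (s1 * r5) = s1 * cc_value m r1 r2 r3 r4 r5"
      by (simp add: cc_value_def algebra_simps)
    then have "[cc_value m (s1 * r1) (s1 * r2) (s1 * r3) (s1 * r4) (s1 * r5) = 0] (mod cc_order m)"
      unfolding r_defs by (simp add: cc_value_rel cong_0_iff)
    then have "P (x1 - s1 * r1, x2 - s1 * r2, x3 - s1 * r3, x4 - s1 * r4, x5 - s1 * r5)"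
      using cong_diff[OF rep, of _ 0] by (simp add: P_def cc_value_diff)
    from least[OF this] have le: "\<bar>x1\<bar> + \<bar>x2\<bar> + \<bar>x3\<bar> + \<bar>x4\<bar> + \<bar>x5\<bar> \<le>
      \<bar>x1 - s1 * r1\<bar> + \<bar>x2 - s1 * r2\<bar> + \<bar>x3 - s1 * r3\<bar> + \<bar>x4 - s1 * r4\<bar> + \<bar>x5 - s1 * r5\<bar>"
      unfolding f_def x prod.case by (subst (asm) nat_le_eq_zle) simp_all
    \<comment> \<open>No sign remains in the first coordinate because
      \<open>s1 * s1 = 1\<close>.\<close>
    have eq1: "\<bar>x1 - s1 * r1\<bar> = \<bar>x1\<bar> + \<bar>r1\<bar> - 2 * min \<bar>x1\<bar> (max 0 r1)"
      by (auto simp: s_defs min_def max_def)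
    have eq: "\<bar>z - s1 * r\<bar> = \<bar>z\<bar> + \<bar>r\<bar> - 2 * min \<bar>z\<bar> (max 0 (s1 * t * r))"
      if "t = (if 0 \<le> z then 1 else -1)" for z r t
      using that by (auto simp: s_defs min_def max_def)
    have sum_le: "2 * (c1 + c2 + c3 + c4 + c5) \<le> d1 + d2 + d3 + d4 + d5"
      if "z1 + z2 + z3 + z4 + z5 \<le> (z1 + d1 - 2 * c1) + (z2 + d2 - 2 * c2) + (z3 + d3 - 2 * c3) +
        (z4 + d4 - 2 * c4) + (z5 + d5 - 2 * c5)"
      for z1 z2 z3 z4 z5 c1 c2 c3 c4 c5 d1 d2 d3 d4 d5 :: int
      using that by (simp add: algebra_simps)
    show ?thesis
      unfolding r_defs[symmetric]
      by (rule sum_le[OF le[unfolded eq1 eq[OF s_defs(2)] eq[OF s_defs(3)] eq[OF s_defs(4)] eq[OF s_defs(5)]]])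
  qed
  have "\<bar>x1\<bar> + \<bar>x2\<bar> + \<bar>x3\<bar> + \<bar>x4\<bar> + \<bar>x5\<bar> \<le> 5 * m + 4"
    by (rule orthant_l1_norm_le[OF assms _ _ _ _ _ _ _ _ _ overlap]) (use s in auto)
  with rep show ?thesis by blast
qed

text \<open>For \<open>m = 0\<close> an explicit table serves: its entry at position
  \<open>w\<close>, counted from 0, represents \<open>w\<close> modulo 457. Positions 0 to 228
  suffice, because 457 = 2 * 228 + 1 and negating a vector negates its residue and keeps its
  norm.\<close>

lemma exists_short_rep_0:
  fixes v :: int
  shows "\<exists>x1 x2 x3 x4 x5. [cc_value 0 x1 x2 x3 x4 x5 = v] (mod cc_order 0) \<and>
    \<bar>x1\<bar> + \<bar>x2\<bar> + \<bar>x3\<bar> + \<bar>x4\<bar> + \<bar>x5\<bar> \<le> 4"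
proof -
  define tab :: "(int \<times> int \<times> int \<times> int \<times> int) list" where "tab =
    [
      (0,0,0,0,0), (1,0,0,0,0), (2,0,0,0,0), (3,0,0,0,0), (4,0,0,0,0), (0,0,-2,0,-1),
      (1,0,-2,0,-1), (0,1,0,3,0), (0,1,1,-1,0), (1,1,1,-1,0), (0,0,-1,1,2), (0,-3,1,0,0),
      (0,0,2,0,-1), (1,0,2,0,-1), (0,-1,0,2,1), (-2,0,0,0,-2), (-1,0,0,0,-2), (0,0,0,0,-2),
      (0,1,0,0,2), (1,1,0,0,2), (0,-1,-1,-2,0), (-1,0,1,1,1), (0,0,1,1,1), (1,0,1,1,1),
      (0,-2,0,-1,-1), (-2,0,-1,1,0), (-1,0,-1,1,0), (0,0,-1,1,0), (1,0,-1,1,0), (2,0,-1,1,0),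
      (0,1,2,0,1), (0,-1,0,2,-1), (-3,1,0,0,0), (-2,1,0,0,0), (-1,1,0,0,0), (0,1,0,0,0),
      (1,1,0,0,0), (2,1,0,0,0), (3,1,0,0,0), (0,0,1,1,-1), (1,0,1,1,-1), (-1,-1,0,-1,1),
      (0,-1,0,-1,1), (0,2,1,-1,0), (0,0,-1,1,-2), (-1,-2,1,0,0), (0,-2,1,0,0), (1,-2,1,0,0),
      (-1,0,0,2,1), (0,0,0,2,1), (1,0,0,2,1), (-1,1,0,0,-2), (0,1,0,0,-2), (0,2,0,0,2),
      (0,0,-2,2,0), (0,0,-1,-2,0), (1,0,-1,-2,0), (0,1,1,1,1), (-1,-1,0,-1,-1), (0,-1,0,-1,-1),
      (0,0,0,-1,3), (0,0,2,2,0), (0,1,-1,1,0), (1,1,-1,1,0), (0,-1,1,0,2), (-1,0,0,2,-1),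
      (0,0,0,2,-1), (1,0,0,2,-1), (-2,2,0,0,0), (-1,2,0,0,0), (0,2,0,0,0), (1,2,0,0,0),
      (2,2,0,0,0), (0,-2,0,1,0), (1,-2,0,1,0), (-2,0,0,-1,1), (-1,0,0,-1,1), (0,0,0,-1,1),
      (1,0,0,-1,1), (2,0,0,-1,1), (-1,-1,1,0,0), (0,-1,1,0,0), (1,-1,1,0,0), (2,-1,1,0,0),
      (0,1,0,2,1), (-1,-1,-1,0,-1), (0,-1,-1,0,-1), (0,2,0,0,-2), (0,0,1,3,0), (0,0,2,-1,0),
      (1,0,2,-1,0), (0,-1,0,1,2), (-2,0,0,-1,-1), (-1,0,0,-1,-1), (0,0,0,-1,-1), (1,0,0,-1,-1),
      (2,0,0,-1,-1), (0,2,-1,1,0), (-1,0,1,0,2), (0,0,1,0,2), (1,0,1,0,2), (0,1,0,2,-1),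
      (-2,0,-1,0,1), (-1,0,-1,0,1), (0,0,-1,0,1), (0,3,0,0,0), (1,3,0,0,0), (-1,-1,0,1,0),
      (0,-1,0,1,0), (1,-1,0,1,0), (2,-1,0,1,0), (0,0,3,0,1), (0,1,0,-1,1), (-3,0,1,0,0),
      (-2,0,1,0,0), (-1,0,1,0,0), (0,0,1,0,0), (1,0,1,0,0), (2,0,1,0,0), (3,0,1,0,0),
      (-1,0,-1,0,-1), (0,0,-1,0,-1), (1,0,-1,0,-1), (2,0,-1,0,-1), (0,1,2,-1,0), (-1,0,0,1,2),
      (0,0,0,1,2), (1,0,0,1,2), (0,0,3,0,-1), (0,1,0,-1,-1), (1,1,0,-1,-1), (0,0,-2,1,1),
      (-1,0,1,0,-2), (0,0,1,0,-2), (0,1,1,0,2), (0,-1,-1,2,0), (0,-1,0,-2,0), (1,-1,0,-2,0),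
      (0,0,2,1,1), (0,1,-1,0,1), (0,4,0,0,0), (-2,0,0,1,0), (-1,0,0,1,0), (0,0,0,1,0),
      (1,0,0,1,0), (2,0,0,1,0), (3,0,0,1,0), (0,2,0,-1,1), (0,0,-2,1,-1), (-2,1,1,0,0),
      (-1,1,1,0,0), (0,1,1,0,0), (1,1,1,0,0), (2,1,1,0,0), (0,0,0,-2,2), (0,0,2,1,-1),
      (0,1,-1,0,-1), (1,1,-1,0,-1), (0,-1,1,-1,1), (-1,0,0,1,-2), (0,0,0,1,-2), (0,1,0,1,2),
      (0,-2,2,0,0), (0,-1,-1,-1,0), (0,2,0,-1,-1), (0,0,1,2,1), (-1,-2,0,0,-1), (0,-2,0,0,-1),
      (0,1,1,0,-2), (-2,0,0,-2,0), (0,0,-1,2,0), (0,0,0,-2,0), (1,0,0,-2,0), (2,0,0,-2,0),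
      (0,2,-1,0,1), (0,-1,1,-1,-1), (-2,1,0,1,0), (-1,1,0,1,0), (0,1,0,1,0), (1,1,0,1,0),
      (2,1,0,1,0), (0,0,-1,-1,2), (0,0,1,2,-1), (-2,-1,0,0,1), (-1,-1,0,0,1), (0,-1,0,0,1),
      (0,2,1,0,0), (1,2,1,0,0), (0,0,0,-2,-2), (0,-2,1,1,0), (0,-1,-2,0,0), (1,-1,-2,0,0),
      (0,0,0,3,1), (0,0,1,-1,1), (1,0,1,-1,1), (0,1,0,1,-2), (-1,-1,2,0,0), (0,-1,2,0,0),
      (0,0,-1,-1,0), (1,0,-1,-1,0), (2,0,-1,-1,0), (-1,-1,0,0,-1), (0,-1,0,0,-1), (0,0,0,0,3),
      (1,0,0,0,3), (0,1,-1,2,0), (0,1,0,-2,0), (1,1,0,-2,0), (0,0,-2,0,2), (0,0,0,3,-1),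
      (0,0,1,-1,-1), (1,0,1,-1,-1), (-1,2,0,1,0), (0,2,0,1,0), (1,2,0,1,0), (0,0,2,0,2),
      (0,-2,0,2,0), (-3,0,0,0,1), (-2,0,0,0,1), (-1,0,0,0,1), (0,0,0,0,1), (1,0,0,0,1),
      (2,0,0,0,1), (3,0,0,0,1), (0,-1,1,1,0), (0,0,-2,0,0), (1,0,-2,0,0), (2,0,-2,0,0),
      (0,1,1,-1,1)]"
  have residues: "map (\<lambda>(x1, x2, x3, x4, x5). (x1 + x2 * 35 + x3 * 116 + x4 * 143 + x5 * 220) mod 457) tab
      = [0..228]"
    unfolding tab_def by code_simp
  have norms: "\<forall>(x1, x2, x3, x4, x5)\<in>set tab. \<bar>x1\<bar> + \<bar>x2\<bar> + \<bar>x3\<bar> + \<bar>x4\<bar> + \<bar>x5\<bar> \<le> 4"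
    unfolding tab_def by code_simp
  have short: "\<exists>x1 x2 x3 x4 x5. [cc_value 0 x1 x2 x3 x4 x5 = w] (mod 457) \<and>
    \<bar>x1\<bar> + \<bar>x2\<bar> + \<bar>x3\<bar> + \<bar>x4\<bar> + \<bar>x5\<bar> \<le> 4" if "0 \<le> w" "w \<le> 228" for w
  proof -
    from that have "w \<in> set [0..228]" by simp
    then obtain x1 x2 x3 x4 x5 where x: "(x1, x2, x3, x4, x5) \<in> set tab"
      "w = (x1 + x2 * 35 + x3 * 116 + x4 * 143 + x5 * 220) mod 457"
      unfolding residues[symmetric] by auto
    then have "[cc_value 0 x1 x2 x3 x4 x5 = w] (mod 457)"
      by (simp add: cc_value_def cc_defs)
    with norms x(1) show ?thesis by blast
  qed
  define w where "w = v mod 457"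
  have w: "0 \<le> w" "w < 457" "[w = v] (mod 457)"
    by (simp_all add: w_def)
  show ?thesis
  proof (cases "w \<le> 228")
    case True
    then show ?thesis
      using short[of w] w by (simp add: cc_order_def) (meson cong_trans)
  next
    case False
    then obtain x1 x2 x3 x4 x5 where x: "[cc_value 0 x1 x2 x3 x4 x5 = 457 - w] (mod 457)"
      "\<bar>x1\<bar> + \<bar>x2\<bar> + \<bar>x3\<bar> + \<bar>x4\<bar> + \<bar>x5\<bar> \<le> 4"
      using short[of "457 - w"] w by auto
    have "[0 - cc_value 0 x1 x2 x3 x4 x5 = 457 - (457 - w)] (mod 457)"
      by (rule cong_diff[OF _ x(1)]) (simp add: cong_def)
    moreover have "cc_value 0 (- x1) (- x2) (- x3) (- x4) (- x5) = 0 - cc_value 0 x1 x2 x3 x4 x5"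
      by (simp add: cc_value_def)
    ultimately have "[cc_value 0 (- x1) (- x2) (- x3) (- x4) (- x5) = v] (mod cc_order 0)"
      using w(3) by (simp add: cc_order_def) (meson cong_trans)
    moreover have "\<bar>- x1\<bar> + \<bar>- x2\<bar> + \<bar>- x3\<bar> + \<bar>- x4\<bar> + \<bar>- x5\<bar> \<le> 4"
      using x(2) by simp
    ultimately show ?thesis by blast
  qed
qed

text \<open>Two vectors of the same value modulo \<open>cc_order m\<close> differ by a relation, so
  the lattice estimate covers all representatives.\<close>

lemma hole_rep_ge:
  fixes m :: int
  assumes "0 \<le> m"
    and "[cc_value m y1 y2 y3 y4 y5 = cc_value m (m + 1) (m + 1) m (m + 1) (m + 1)] (mod cc_order m)"
  shows "5 * m + 4 \<le> \<bar>y1\<bar> + \<bar>y2\<bar> + \<bar>y3\<bar> + \<bar>y4\<bar> + \<bar>y5\<bar>"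
proof (cases "m = 0")
  case True
  then show ?thesis using hole_l1_norm_ge_0[of y1 y2 y3 y4 y5] assms(2) by simp
next
  case False
  have "[cc_value m (y1 - (m + 1)) (y2 - (m + 1)) (y3 - m) (y4 - (m + 1)) (y5 - (m + 1)) = 0] (mod cc_order m)"
    using assms(2) by (simp add: cc_value_diff cong_diff_iff_cong_0)
  then obtain a1 a2 a3 a4 b where
    "y1 - (m + 1) = rel1 m a1 a2 a3 a4 0 b" "y2 - (m + 1) = rel2 m a1 a2 a3 a4 0 b"
    "y3 - m = rel3 m a1 a2 a3 a4 0 b" "y4 - (m + 1) = rel4 m a1 a2 a3 a4 0 b"
    "y5 - (m + 1) = rel5 m a1 a2 a3 a4 0 b"
    by (rule cc_value_eq_0_cong_imp_rel)
  then have "y1 = m + 1 + rel1 m a1 a2 a3 a4 0 b" "y2 = m + 1 + rel2 m a1 a2 a3 a4 0 b"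
    "y3 = m + rel3 m a1 a2 a3 a4 0 b" "y4 = m + 1 + rel4 m a1 a2 a3 a4 0 b"
    "y5 = m + 1 + rel5 m a1 a2 a3 a4 0 b"
    by linarith+
  then show ?thesis
    using hole_l1_norm_ge[of m a1 a2 a3 a4 0 b] False assms(1) by simp
qed

section \<open>Words in the generators against coordinate vectors, and the diameter\<close>

lemma steps_of_multiple:
  fixes g x :: int
  assumes "g \<in> S"
  shows "\<exists>ss. set ss \<subseteq> S \<union> uminus ` S \<and> int (length ss) = \<bar>x\<bar> \<and> sum_list ss = x * g"
proof (cases "0 \<le> x")
  case True
  then show ?thesis
    using assms by (intro exI[of _ "replicate (nat x) g"]) (auto simp: sum_list_replicate)
next
  case False
  then show ?thesis
    using assms by (intro exI[of _ "replicate (nat (- x)) (- g)"]) (auto simp: sum_list_replicate)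
qed

definition cc_gens :: "int \<Rightarrow> int set" where
  "cc_gens m = {1, cc_gen2 m, cc_gen3 m, cc_gen4 m, cc_gen5 m}"

lemma steps_of_cc_value:
  "\<exists>ss. set ss \<subseteq> cc_gens m \<union> uminus ` cc_gens m \<and>
    int (length ss) = \<bar>x1\<bar> + \<bar>x2\<bar> + \<bar>x3\<bar> + \<bar>x4\<bar> + \<bar>x5\<bar> \<and> sum_list ss = cc_value m x1 x2 x3 x4 x5"
proof -
  let ?S = "cc_gens m"
  let ?Q = "\<lambda>ss x g. set ss \<subseteq> ?S \<union> uminus ` ?S \<and> int (length ss) = \<bar>x\<bar> \<and> sum_list ss = x * g"
  have steps: "\<exists>ss. ?Q ss x g" if "g \<in> ?S" for x g
    using that by (rule steps_of_multiple)
  have gens: "1 \<in> ?S" "cc_gen2 m \<in> ?S" "cc_gen3 m \<in> ?S" "cc_gen4 m \<in> ?S" "cc_gen5 m \<in> ?S"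
    by (simp_all add: cc_gens_def)
  obtain ss1 where "?Q ss1 x1 1" using steps[OF gens(1)] ..
  moreover obtain ss2 where "?Q ss2 x2 (cc_gen2 m)" using steps[OF gens(2)] ..
  moreover obtain ss3 where "?Q ss3 x3 (cc_gen3 m)" using steps[OF gens(3)] ..
  moreover obtain ss4 where "?Q ss4 x4 (cc_gen4 m)" using steps[OF gens(4)] ..
  moreover obtain ss5 where "?Q ss5 x5 (cc_gen5 m)" using steps[OF gens(5)] ..
  ultimately show ?thesis
    by (intro exI[of _ "ss1 @ ss2 @ ss3 @ ss4 @ ss5"]) (simp add: cc_value_def)
qed

text \<open>Each step adds a signed unit vector to the coordinates. Opposite steps cancel, hence the
  inequality.\<close>

lemma cc_value_of_steps:
  assumes "set ss \<subseteq> cc_gens m \<union> uminus ` cc_gens m"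
  shows "\<exists>x1 x2 x3 x4 x5. \<bar>x1\<bar> + \<bar>x2\<bar> + \<bar>x3\<bar> + \<bar>x4\<bar> + \<bar>x5\<bar> \<le> int (length ss) \<and>
    sum_list ss = cc_value m x1 x2 x3 x4 x5"
  using assms
proof (induction ss)
  case Nil
  show ?case
    by (rule exI[of _ 0])+ (simp add: cc_value_def)
next
  case (Cons g ss)
  then obtain x1 x2 x3 x4 x5 where
    x: "\<bar>x1\<bar> + \<bar>x2\<bar> + \<bar>x3\<bar> + \<bar>x4\<bar> + \<bar>x5\<bar> \<le> int (length ss)" "sum_list ss = cc_value m x1 x2 x3 x4 x5"
    by auto
  from Cons.prems consider
      (plus) "g \<in> cc_gens m" | (minus) "- g \<in> cc_gens m" by auto
  then obtain e1 e2 e3 e4 e5 where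
    e: "\<bar>e1\<bar> + \<bar>e2\<bar> + \<bar>e3\<bar> + \<bar>e4\<bar> + \<bar>e5\<bar> = 1" "g = cc_value m e1 e2 e3 e4 e5"
  proof cases
    case plus
    then show thesis
      using that[of 1 0 0 0 0] that[of 0 1 0 0 0] that[of 0 0 1 0 0] that[of 0 0 0 1 0] that[of 0 0 0 0 1]
      by (auto simp: cc_gens_def cc_value_def)
  next
    case minus
    then have "g = - 1 \<or> g = - cc_gen2 m \<or> g = - cc_gen3 m \<or> g = - cc_gen4 m \<or> g = - cc_gen5 m"
      by (auto simp: cc_gens_def)
    then show thesis
      using that[of "-1" 0 0 0 0] that[of 0 "-1" 0 0 0] that[of 0 0 "-1" 0 0] that[of 0 0 0 "-1" 0]
        that[of 0 0 0 0 "-1"]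
      by (auto simp: cc_value_def)
  qed
  have "sum_list (g # ss) = cc_value m (x1 + e1) (x2 + e2) (x3 + e3) (x4 + e4) (x5 + e5)"
    by (simp add: x(2) e(2)) (simp add: cc_value_def algebra_simps)
  moreover have "\<bar>x1 + e1\<bar> + \<bar>x2 + e2\<bar> + \<bar>x3 + e3\<bar> + \<bar>x4 + e4\<bar> + \<bar>x5 + e5\<bar> \<le> int (length (g # ss))"
    using x(1) e(1) abs_triangle_ineq[of x1 e1] abs_triangle_ineq[of x2 e2] abs_triangle_ineq[of x3 e3]
      abs_triangle_ineq[of x4 e4] abs_triangle_ineq[of x5 e5]
    unfolding length_Cons of_nat_Suc by (smt (verit))
  ultimately show ?case by blast
qed

lemma cc_order_pos:
  assumes "0 \<le> m"
  shows "0 < cc_order m"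
proof -
  have "0 \<le> m ^ i" for i using assms by simp
  from this[of 2] this[of 3] this[of 4] this[of 5] show ?thesis
    using assms unfolding cc_defs by linarith
qed

text \<open>This chain shows that the generators are five distinct residues, already reduced modulo
  \<open>cc_order m\<close>.\<close>

lemma cc_gens_increasing:
  assumes "0 \<le> m"
  shows "1 < cc_gen2 m" "cc_gen2 m < cc_gen3 m" "cc_gen3 m < cc_gen4 m"
    "cc_gen4 m < cc_gen5 m" "cc_gen5 m < cc_order m"
proof -
  have "0 \<le> m ^ i" for i using assms by simp
  from assms this[of 2] this[of 3] this[of 4] this[of 5]
  show "1 < cc_gen2 m" "cc_gen2 m < cc_gen3 m" "cc_gen3 m < cc_gen4 m"
    "cc_gen4 m < cc_gen5 m" "cc_gen5 m < cc_order m"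
    unfolding cc_defs by linarith+
qed

lemma graph_diameter_cc_gens:
  assumes "0 \<le> m"
  shows "graph_diameter (with_proj (cyclic_cayley_graph (cc_order m) (cc_gens m))) =
    ereal (of_int (5 * m + 4))"
proof -
  have "graph_diameter (with_proj (cyclic_cayley_graph (cc_order m) (cc_gens m))) =
    ereal (real (nat (5 * m + 4)))"
  proof (rule graph_diameter_cyclic_cayley_graph_eqI)
    show "0 < cc_order m"
      using assms by (rule cc_order_pos)
    show "\<exists>ss. set ss \<subseteq> cc_gens m \<union> uminus ` cc_gens m \<and> length ss \<le> nat (5 * m + 4) \<and>
      [sum_list ss = v] (mod cc_order m)" for v
    proof -
      have "\<exists>x1 x2 x3 x4 x5. [cc_value m x1 x2 x3 x4 x5 = v] (mod cc_order m) \<and>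
        \<bar>x1\<bar> + \<bar>x2\<bar> + \<bar>x3\<bar> + \<bar>x4\<bar> + \<bar>x5\<bar> \<le> 5 * m + 4"
      proof (cases "m = 0")
        case True
        then show ?thesis using exists_short_rep_0[of v] by simp
      next
        case False
        with assms show ?thesis by (intro exists_short_rep) simp
      qed
      then obtain x1 x2 x3 x4 x5 where x: "[cc_value m x1 x2 x3 x4 x5 = v] (mod cc_order m)"
        "\<bar>x1\<bar> + \<bar>x2\<bar> + \<bar>x3\<bar> + \<bar>x4\<bar> + \<bar>x5\<bar> \<le> 5 * m + 4"
        by blast
      obtain ss where ss: "set ss \<subseteq> cc_gens m \<union> uminus ` cc_gens m"
        "int (length ss) = \<bar>x1\<bar> + \<bar>x2\<bar> + \<bar>x3\<bar> + \<bar>x4\<bar> + \<bar>x5\<bar>" "sum_list ss = cc_value m x1 x2 x3 x4 x5"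
        using steps_of_cc_value by blast
      have "int (length ss) \<le> 5 * m + 4"
        unfolding ss(2) by (rule x(2))
      then have "length ss \<le> nat (5 * m + 4)"
        by linarith
      with ss(1,3) x(1) show ?thesis
        by (intro exI[of _ ss]) simp
    qed
    \<comment> \<open>The residue \<open>v0\<close> is the value of the vector
      \<open>(m+1, m+1, m, m+1, m+1)\<close>, so \<open>hole_rep_ge\<close> applies to the
      coordinates of the word.\<close>
    show "nat (5 * m + 4) \<le> length ss"
      if ss: "set ss \<subseteq> cc_gens m \<union> uminus ` cc_gens m"
        "[sum_list ss = cc_value m (m + 1) (m + 1) m (m + 1) (m + 1)] (mod cc_order m)" for ss
    proof -
      obtain x1 x2 x3 x4 x5 where "\<bar>x1\<bar> + \<bar>x2\<bar> + \<bar>x3\<bar> + \<bar>x4\<bar> + \<bar>x5\<bar> \<le> int (length ss)"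
        "sum_list ss = cc_value m x1 x2 x3 x4 x5"
        using cc_value_of_steps[OF ss(1)] by blast
      with hole_rep_ge[OF assms, of x1 x2 x3 x4 x5] ss(2) have "5 * m + 4 \<le> int (length ss)"
        by simp
      then show ?thesis by linarith
    qed
  qed
  with assms show ?thesis by simp
qed

section \<open>Return from \<open>m\<close> to \<open>k\<close>\<close>

text \<open>Here the residue class of \<open>k\<close> modulo 5 enters: for
  \<open>k = 5 * m + 4\<close> the numerator is a multiple of 3125 identically in
  \<open>m\<close>.\<close>

lemma L_CC_10_eq: "L_CC_10 (5 * m + 4) = of_int (cc_order m)"
proof -
  have "512 * (5 * m + 4)^5 + 1280 * (5 * m + 4)^4 + 6400 * (5 * m + 4)^3 + 8640 * (5 * m + 4)^2
    + 6890 * (5 * m + 4) + 757 = 3125 * cc_order m"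
    unfolding cc_defs by algebra
  then show ?thesis unfolding L_CC_10_def by (simp only: of_int_mult)
qed

lemma L_CC_10_generators_eq: "L_CC_10_generators (5 * m + 4) = of_int ` cc_gens m"
proof -
  let ?k = "5 * m + 4"
  have "32 * ?k^3 + 56 * ?k^2 + 316 * ?k + 167 = 125 * cc_gen2 m"
    "128 * ?k^4 + 192 * ?k^3 + 1408 * ?k^2 + 1002 * ?k + 908 = 625 * cc_gen3 m"
    "128 * ?k^4 + 352 * ?k^3 + 1488 * ?k^2 + 2432 * ?k + 543 = 625 * cc_gen4 m"
    "256 * ?k^4 + 384 * ?k^3 + 2616 * ?k^2 + 1354 * ?k + 116 = 625 * cc_gen5 m"
    unfolding cc_defs by algebra+
  then show ?thesis
    unfolding L_CC_10_generators_def cc_gens_def by (simp only: of_int_mult) simp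
qed

theorem theorem9:
  fixes k :: int
  assumes "k > 0" and "[k = 4] (mod 5)"
  shows "\<exists>n :: int. n > 0 \<and> of_int n = L_CC_10 k \<and>
    (\<exists>T. T \<subseteq> {0..<n} \<and> card T = 5 \<and>
         graph_diameter (with_proj (cyclic_cayley_graph n T)) = ereal (of_int k)) \<and>
    (\<exists>S :: int set. of_int ` S = L_CC_10_generators k \<and>
         card ((\<lambda>g. g mod n) ` S) = 5 \<and>
         graph_diameter (with_proj (cyclic_cayley_graph n S)) = ereal (of_int k))"
proof -
  define m where "m = k div 5"
  have k: "k = 5 * m + 4" and m: "0 \<le> m"
    using assms unfolding m_def cong_def by presburger+
  note inc = cc_gens_increasing[OF m]
  have sub: "cc_gens m \<subseteq> {0..<cc_order m}" and card: "card (cc_gens m) = 5"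
    using inc by (auto simp: cc_gens_def)
  have "(\<lambda>g. g mod cc_order m) ` cc_gens m = (\<lambda>g. g) ` cc_gens m"
    using sub by (intro image_cong) auto
  with card have card_mod: "card ((\<lambda>g. g mod cc_order m) ` cc_gens m) = 5"
    by simp
  note diam = graph_diameter_cc_gens[OF m, folded k]
  show ?thesis
  proof (intro exI[of _ "cc_order m"] conjI)
    show "cc_order m > 0"
      using m by (rule cc_order_pos)
    show "of_int (cc_order m) = L_CC_10 k"
      unfolding k L_CC_10_eq ..
    \<comment> \<open>The generators are reduced residues, so \<open>cc_gens m\<close> serves as
      \<open>T\<close> and, below, as \<open>S\<close>.\<close>
    show "\<exists>T\<subseteq>{0..<cc_order m}. card T = 5 \<and>
      graph_diameter (with_proj (cyclic_cayley_graph (cc_order m) T)) = ereal (of_int k)"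
      using sub card diam by blast
    show "\<exists>S :: int set. of_int ` S = L_CC_10_generators k \<and>
      card ((\<lambda>g. g mod cc_order m) ` S) = 5 \<and>
      graph_diameter (with_proj (cyclic_cayley_graph (cc_order m) S)) = ereal (of_int k)"
      using card_mod diam unfolding k L_CC_10_generators_eq by blast
  qed
qed

end
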